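(* Let $\delta^0>0$ be a given accuracy parameter. Let $f:\mathbb{R}^n\to\mathbb{R}$ be convex with bounded level sets, and suppose there exist a point $\bar x\in\mathbb{R}^n$ and $\epsilon>0$ such that $\langle a_j,\bar x\rangle-b_j\le-\epsilon$ for all $j=1,\ldots,m$. Let $L=L(c,\epsilon)$ be the subgradient bound defined in the context, with some $c>4\alpha_{\min}\delta^0$. Let the penalty parameters $\gamma>0$ and $\delta$ be chosen such that $$0<\delta<\min\left\{\epsilon,\frac{16\alpha_{\min}^2}{\beta^2m^2}\right\},\qquad \Gamma\le\gamma\le\frac{4\alpha_{\min}\delta^0}{\delta},$$ where $$\Gamma=\max\left\{L\left(\frac{1}{m\beta}-\frac{\sqrt{\delta}}{4\alpha_{\min}}\right)^{-1},\ 4mL\alpha_{\max}\left(\frac{1}{\sqrt{\delta}}+\frac{\beta m}{\alpha_{\min}}\right)\right\}.$$ Then, with $f^*=\min_{z\in X}f(z)$, $$0\le f(x^*_{\gamma\delta})-f^*\le\delta^0\qquad\text{for any }x^*_{\gamma\delta}\in X^*_{\gamma\delta}.$$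
   Context: Original problem: minimize a convex function $f:\mathbb{R}^n\to\mathbb{R}$ subject to $\langle a_i,x\rangle-b_i\le0$, $i=1,\ldots,m$ ($m\ge2$), where $a_i\in\mathbb{R}^n$ are nonzero and $b_i\in\mathbb{R}$. The problem is feasible. Put $X_i=\{x\in\mathbb{R}^n\mid\langle a_i,x\rangle-b_i\le0\}$ and $X=\cap_{i=1}^mX_i$. Norms are Euclidean, $\Pi_Y[x]$ is the Euclidean projection onto a closed convex set $Y$, and $\mathrm{dist}(x,Y)=\|x-\Pi_Y[x]\|$. For nonzero $a\in\mathbb{R}^n$, $b\in\mathbb{R}$ and $\delta>0$: $h_\delta(x;a,b)=\frac{\langle a,x\rangle-b}{\|a\|}$ if $\langle a,x\rangle-b>\delta$; $h_\delta(x;a,b)=\frac{(\langle a,x\rangle-b+\delta)^2}{4\delta\|a\|}$ if $-\delta\le\langle a,x\rangle-b\le\delta$; $h_\delta(x;a,b)=0$ if $\langle a,x\rangle-b<-\delta$. Penalized objective: $F_{\gamma\delta}(x)=f(x)+\frac{\gamma}{m}\sum_{i=1}^mh_\delta(x;a_i,b_i)$. $X^*_{\gamma\delta}$ is the set of minimizers of $F_{\gamma\delta}$ over $\mathbb{R}^n$. $\alpha_{\min}=\min_j\|a_j\|$, $\alpha_{\max}=\max_j\|a_j\|$. Hoffman's constant: $\beta=\beta(a_1,\ldots,a_m)>0$ is a constant depending only on $a_1,\ldots,a_m$ (not on the right-hand sides) such that, for every choice of right-hand sides $b'_1,\ldots,b'_m\in\mathbb{R}$ for which $Y=\cap_iY_i\ne\emptyset$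 with $Y_i=\{x\mid\langle a_i,x\rangle\le b'_i\}$, one has $\beta\sum_{i=1}^m\mathrm{dist}(x,Y_i)\ge\mathrm{dist}(x,Y)$ for all $x\in\mathbb{R}^n$ (in particular for $X_i$ and $X$). Subgradient bound: $R(c,\epsilon)>0$ is a radius such that, for all $\gamma>0$ and $0<\delta\le\epsilon$ with $\gamma\delta\le c$ and every $x\in X^*_{\gamma\delta}$, the ball $\{z\mid\|z\|\le R(c,\epsilon)\}$ contains $\Pi_X[x]$ and every feasible point $x_{in}\in X$ satisfying $\|x-x_{in}\|\le\|x-\Pi_X[x]\|+\frac{\beta m\delta}{\alpha_{\min}}$ (such a radius exists when $f$ has bounded level sets). Then $L(c,\epsilon)=\max\{\|s\|\mid s\in\partial f(x),\ \|x\|\le R(c,\epsilon)\}$, where $\partial f(x)$ is the subdifferential. *)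

theory Defs
  imports "HOL-Analysis.Analysis"
begin

definition halfspace_le :: "real^'n \<Rightarrow> real \<Rightarrow> (real^'n) set" where
  "halfspace_le a b = {x. a \<bullet> x - b \<le> 0}"

text \<open>The constraints are indexed by \<open>1, \<dots>, m\<close>; values of \<open>a\<close> and \<open>b\<close> at other indices are
  never used.\<close>

definition feasible_set :: "nat \<Rightarrow> (nat \<Rightarrow> real^'n) \<Rightarrow> (nat \<Rightarrow> real) \<Rightarrow> (real^'n) set" where
  "feasible_set m a b = (\<Inter>i\<in>{1..m}. halfspace_le (a i) (b i))"

definition proj_dist :: "real^'n \<Rightarrow> (real^'n) set \<Rightarrow> real" where
  "proj_dist x Y = norm (x - closest_point Y x)"

definition penalty :: "real \<Rightarrow> real^'n \<Rightarrow> real^'n \<Rightarrow> real \<Rightarrow> real" where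
  "penalty \<delta> x a b =
     (if a \<bullet> x - b > \<delta> then (a \<bullet> x - b) / norm a
      else if - \<delta> \<le> a \<bullet> x - b then (a \<bullet> x - b + \<delta>)\<^sup>2 / (4 * \<delta> * norm a)
      else 0)"

definition penalized_objective ::
  "nat \<Rightarrow> (nat \<Rightarrow> real^'n) \<Rightarrow> (nat \<Rightarrow> real) \<Rightarrow> (real^'n \<Rightarrow> real) \<Rightarrow> real \<Rightarrow> real \<Rightarrow> real^'n \<Rightarrow> real" where
  "penalized_objective m a b f \<gamma> \<delta> x =
     f x + \<gamma> / real m * (\<Sum>i\<in>{1..m}. penalty \<delta> x (a i) (b i))"

definition penalized_minimizers ::
  "nat \<Rightarrow> (nat \<Rightarrow> real^'n) \<Rightarrow> (nat \<Rightarrow> real) \<Rightarrow> (real^'n \<Rightarrow> real) \<Rightarrow> real \<Rightarrow> real \<Rightarrow> (real^'n) set" where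
  "penalized_minimizers m a b f \<gamma> \<delta> =
     {x. \<forall>y. penalized_objective m a b f \<gamma> \<delta> x \<le> penalized_objective m a b f \<gamma> \<delta> y}"

definition alpha_min :: "nat \<Rightarrow> (nat \<Rightarrow> real^'n) \<Rightarrow> real" where
  "alpha_min m a = Min ((\<lambda>j. norm (a j)) ` {1..m})"

definition alpha_max :: "nat \<Rightarrow> (nat \<Rightarrow> real^'n) \<Rightarrow> real" where
  "alpha_max m a = Max ((\<lambda>j. norm (a j)) ` {1..m})"

definition hoffman_constant :: "nat \<Rightarrow> (nat \<Rightarrow> real^'n) \<Rightarrow> real \<Rightarrow> bool" where
  "hoffman_constant m a \<beta> \<longleftrightarrow>
     \<beta> > 0 \<and>
     (\<forall>b'. feasible_set m a b' \<noteq> {} \<longrightarrow>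
        (\<forall>x. proj_dist x (feasible_set m a b')
              \<le> \<beta> * (\<Sum>i\<in>{1..m}. proj_dist x (halfspace_le (a i) (b' i)))))"

definition subdifferential :: "(real^'n \<Rightarrow> real) \<Rightarrow> real^'n \<Rightarrow> (real^'n) set" where
  "subdifferential f x = {s. \<forall>y. f y \<ge> f x + s \<bullet> (y - x)}"

definition admissible_radius ::
  "nat \<Rightarrow> (nat \<Rightarrow> real^'n) \<Rightarrow> (nat \<Rightarrow> real) \<Rightarrow> (real^'n \<Rightarrow> real) \<Rightarrow> real \<Rightarrow> real \<Rightarrow> real \<Rightarrow> real \<Rightarrow> bool" where
  "admissible_radius m a b f \<beta> c \<epsilon> R \<longleftrightarrow>
     R > 0 \<and>
     (\<forall>\<gamma> \<delta>. \<gamma> > 0 \<longrightarrow> 0 < \<delta> \<longrightarrow> \<delta> \<le> \<epsilon> \<longrightarrow> \<gamma> * \<delta> \<le> c \<longrightarrow>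
        (\<forall>x \<in> penalized_minimizers m a b f \<gamma> \<delta>.
           closest_point (feasible_set m a b) x \<in> cball 0 R \<and>
           (\<forall>x_in \<in> feasible_set m a b.
              norm (x - x_in) \<le> norm (x - closest_point (feasible_set m a b) x)
                                 + \<beta> * real m * \<delta> / alpha_min m a
              \<longrightarrow> x_in \<in> cball 0 R)))"

text \<open>The maximum exists for every finite convex \<open>f\<close> and \<open>R \<ge> 0\<close>: the subgradients of \<open>f\<close> at
  the points of a closed ball form a nonempty compact set.\<close>

definition subgradient_bound :: "(real^'n \<Rightarrow> real) \<Rightarrow> real \<Rightarrow> real" where
  "subgradient_bound f R =
     (GREATEST l. \<exists>x s. norm x \<le> R \<and> s \<in> subdifferential f x \<and> l = norm s)"

end

theory Submission
  imports Defs
begin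

text \<open>
  The bounds on \<open>\<gamma>\<close> make every minimizer \<open>x\<close> of the penalized objective feasible, which gives the
  lower estimate; the upper estimate comes from comparing \<open>x\<close> with a solution of the constrained
  problem.

  Upper estimate: at a feasible point each penalty is at most \<open>\<delta> / (4 \<alpha>\<^sub>m\<^sub>i\<^sub>n)\<close>, and penalties are
  nonnegative, so comparing values of the penalized objective at \<open>x\<close> and at a feasible \<open>z\<close> gives
  \<open>f x \<le> f z + \<gamma> \<delta> / (4 \<alpha>\<^sub>m\<^sub>i\<^sub>n)\<close>, and \<open>\<gamma> \<delta> \<le> 4 \<alpha>\<^sub>m\<^sub>i\<^sub>n \<delta>\<^sup>0\<close>.

  Feasibility: suppose \<open>x\<close> is infeasible, at distance \<open>d > 0\<close> from the feasible set \<open>X\<close>. Subgradients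
  in the ball of radius \<open>R\<close> bound how much \<open>f\<close> can decrease from a point of that ball to \<open>x\<close>
  (\<open>decrease_le_subgradient_bound\<close>). Two competitors exclude two ranges of \<open>d\<close>.

  \<^item> If \<open>d > \<surd>\<delta>\<close>, compare with the projection \<open>p\<close> of \<open>x\<close> onto \<open>X\<close>. The penalties at \<open>x\<close> dominate
    the distances to the half-spaces, so by Hoffman's inequality their sum is at least \<open>d / \<beta>\<close>,
    while at \<open>p\<close> their mean is at most \<open>\<delta> / (4 \<alpha>\<^sub>m\<^sub>i\<^sub>n) < \<surd>\<delta> d / (4 \<alpha>\<^sub>m\<^sub>i\<^sub>n)\<close>. This contradicts the
    first lower bound on \<open>\<gamma>\<close>.
  \<^item> If \<open>d \<le> \<surd>\<delta>\<close>, compare with a point \<open>q\<close> of the set obtained by tightening all constraints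
    by \<open>\<delta>\<close>, where every penalty vanishes. Hoffman's inequality for the tightened system puts \<open>q\<close>
    within \<open>\<beta> m \<delta> / \<alpha>\<^sub>m\<^sub>i\<^sub>n\<close> of \<open>p\<close>. A violated constraint has penalty exceeding \<open>\<delta> / (4 \<alpha>\<^sub>m\<^sub>a\<^sub>x)\<close>
    at \<open>x\<close>, however small the violation. This contradicts the second lower bound on \<open>\<gamma>\<close>.
\<close>

section \<open>Subgradients of finite convex functions\<close>

text \<open>A hyperplane separating the epigraph from the open ray below the point \<open>(q, f q)\<close> cannot be
  vertical, because \<open>f\<close> is finite on the whole space; its slope is a subgradient.\<close>

lemma subgradient_exists:
  fixes f :: "real^'n \<Rightarrow> real"
  assumes "convex_on UNIV f"
  shows "\<exists>s. s \<in> subdifferential f q"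
proof -
  define ray where "ray = {q} \<times> {..<f q}"
  have "convex ray" unfolding ray_def by (intro convex_Times) auto
  moreover have "convex (epigraph UNIV f)" using assms by (rule convex_epigraphI)
  moreover have "(q, f q - 1) \<in> ray" "(q, f q) \<in> epigraph UNIV f"
    by (auto simp: ray_def mem_epigraph)
  then have "ray \<noteq> {}" "epigraph UNIV f \<noteq> {}" by blast+
  moreover have "ray \<inter> epigraph UNIV f = {}" by (auto simp: ray_def mem_epigraph)
  ultimately obtain w k where w: "w \<noteq> 0" "\<forall>z\<in>ray. w \<bullet> z \<le> k" "\<forall>z\<in>epigraph UNIV f. w \<bullet> z \<ge> k"
    using separating_hyperplane_sets[of ray "epigraph UNIV f"] by blast
  obtain u v where uv: "w = (u, v)" by (cases w)
  have below: "u \<bullet> q + v * t \<le> k" if "t < f q" for t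
    using w(2)[rule_format, of "(q, t)"] that by (simp add: ray_def uv)
  have above: "u \<bullet> y + v * t \<ge> k" if "t \<ge> f y" for y t
    using w(3)[rule_format, of "(y, t)"] that by (simp add: mem_epigraph uv)
  have "v \<ge> 0"
    using below[of "f q - 1"] above[of q "f q + 1"] by (simp add: algebra_simps)
  moreover have "v \<noteq> 0"
  proof
    assume "v = 0"
    then have "u \<bullet> q \<le> u \<bullet> (q - u)"
      using below[of "f q - 1"] above[of "q - u" "f (q - u)"] by simp
    then have "u = 0" using inner_gt_zero_iff[of u] by (fastforce simp: inner_diff_right)
    with \<open>v = 0\<close> uv w(1) show False by (simp add: zero_prod_def)
  qed
  ultimately have "v > 0" by simp
  have gap: "u \<bullet> q + v * f q \<le> u \<bullet> y + v * f y" for y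
  proof (rule field_le_epsilon)
    fix e :: real assume "e > 0"
    then have "u \<bullet> q + v * (f q - e / v) \<le> u \<bullet> y + v * f y"
      using below[of "f q - e / v"] above[of y "f y"] \<open>v > 0\<close> by fastforce
    then show "u \<bullet> q + v * f q \<le> u \<bullet> y + v * f y + e"
      using \<open>v > 0\<close> by (simp add: algebra_simps)
  qed
  have "f q + ((- 1 / v) *\<^sub>R u) \<bullet> (y - q) \<le> f y" for y
    using gap[of y] \<open>v > 0\<close> by (simp add: field_simps inner_diff_right)
  then have "(- 1 / v) *\<^sub>R u \<in> subdifferential f q" by (simp add: subdifferential_def)
  then show ?thesis by blast
qed

text \<open>The subgradients at points of a ball are bounded, since a long subgradient at \<open>x\<close> would make
  \<open>f\<close> large one unit away from \<open>x\<close>. With continuity of \<open>f\<close>, the pairs of a point and a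
  subgradient form a compact set, so that the maximum in \<open>subgradient_bound\<close> is attained.\<close>

lemma norm_subgradient_le_bound:
  fixes f :: "real^'n \<Rightarrow> real"
  assumes conv: "convex_on UNIV f" and x0: "norm x0 \<le> R" and s0: "s0 \<in> subdifferential f x0"
  shows "norm s0 \<le> subgradient_bound f R"
proof -
  have cont: "continuous_on UNIV f" using convex_on_continuous[OF open_UNIV conv] .
  have "compact (f ` cball 0 (R + 1))"
    using compact_continuous_image[OF continuous_on_subset[OF cont] compact_cball] by auto
  then obtain M where M: "\<And>x. norm x \<le> R + 1 \<Longrightarrow> \<bar>f x\<bar> \<le> M"
    by (fastforce dest!: compact_imp_bounded simp: bounded_iff)
  have bound: "norm s \<le> 2 * M" if x: "norm x \<le> R" and s: "s \<in> subdifferential f x" for x s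
  proof -
    have "norm (x + sgn s) \<le> R + 1"
      using norm_triangle_ineq[of x "sgn s"] x by (simp add: norm_sgn split: if_splits)
    moreover have "f (x + sgn s) \<ge> f x + s \<bullet> sgn s"
      using s by (auto simp: subdifferential_def dest: spec[of _ "x + sgn s"])
    moreover have "s \<bullet> sgn s = norm s"
      by (cases "s = 0") (simp_all add: sgn_div_norm dot_square_norm power2_eq_square)
    ultimately show ?thesis using M[of x] M[of "x + sgn s"] x by linarith
  qed
  define G where "G = {z. norm (fst z) \<le> R \<and> snd z \<in> subdifferential f (fst z)}"
  have "G = (cball 0 R \<times> cball 0 (2 * M)) \<inter>
      (\<Inter>y. {z. f (fst z) + snd z \<bullet> (y - fst z) \<le> f y})"
  proof -
    have "z \<in> G \<longleftrightarrow> norm (fst z) \<le> R \<and> norm (snd z) \<le> 2 * M \<and>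
        (\<forall>y. f (fst z) + snd z \<bullet> (y - fst z) \<le> f y)" for z
      using bound[of "fst z" "snd z"] by (auto simp: G_def subdifferential_def)
    then show ?thesis by (auto simp: mem_Times_iff)
  qed
  moreover have "closed {z. f (fst z) + snd z \<bullet> (y - fst z) \<le> f y}" for y
    by (intro closed_Collect_le continuous_intros continuous_on_compose2[OF cont]) auto
  ultimately have "compact G"
    by (auto intro!: compact_Int_closed compact_Times)
  moreover have "(x0, s0) \<in> G" using x0 s0 by (simp add: G_def)
  moreover have "continuous_on G (\<lambda>z. norm (snd z))" by (intro continuous_intros)
  ultimately obtain zm where zm: "zm \<in> G" "\<forall>z\<in>G. norm (snd z) \<le> norm (snd zm)"
    using continuous_attains_sup[of G "\<lambda>z. norm (snd z)"] by blast
  have "subgradient_bound f R = norm (snd zm)"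
    unfolding subgradient_bound_def
  proof (rule Greatest_equality)
    show "\<exists>x s. norm x \<le> R \<and> s \<in> subdifferential f x \<and> norm (snd zm) = norm s"
      using zm(1) unfolding G_def by blast
    show "l \<le> norm (snd zm)" if "\<exists>x s. norm x \<le> R \<and> s \<in> subdifferential f x \<and> l = norm s" for l
      using that zm(2) unfolding G_def by fastforce
  qed
  then show ?thesis using zm(2) \<open>(x0, s0) \<in> G\<close> by force
qed

lemma subgradient_bound_nonneg:
  fixes f :: "real^'n \<Rightarrow> real"
  assumes "convex_on UNIV f" and "0 \<le> R"
  shows "0 \<le> subgradient_bound f R"
proof -
  obtain s where "s \<in> subdifferential f 0" using subgradient_exists[OF assms(1)] by blast
  then have "norm s \<le> subgradient_bound f R"
    using norm_subgradient_le_bound[OF assms(1), of 0 R s] assms(2) by simp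
  then show ?thesis using norm_ge_zero[of s] by linarith
qed

text \<open>Only the starting point \<open>q\<close> has to lie in the ball; \<open>x\<close>, for which no a priori bound is
  at hand when it is a minimizer of the penalized objective, is arbitrary.\<close>

lemma decrease_le_subgradient_bound:
  fixes f :: "real^'n \<Rightarrow> real"
  assumes conv: "convex_on UNIV f" and q: "q \<in> cball 0 R"
  shows "f q - f x \<le> subgradient_bound f R * norm (x - q)"
proof -
  obtain s where s: "s \<in> subdifferential f q" using subgradient_exists[OF conv] by blast
  then have "f q + s \<bullet> (x - q) \<le> f x" by (simp add: subdifferential_def)
  then have "f q - f x \<le> - (s \<bullet> (x - q))" by linarith
  also have "\<dots> \<le> norm s * norm (x - q)" using Cauchy_Schwarz_ineq2[of s "x - q"] by linarith
  also have "\<dots> \<le> subgradient_bound f R * norm (x - q)"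
    using norm_subgradient_le_bound[OF conv _ s] q by (intro mult_right_mono) auto
  finally show ?thesis .
qed

section \<open>Half-spaces and the smoothed penalty\<close>

lemma mem_feasible_set:
  "x \<in> feasible_set m a b \<longleftrightarrow> (\<forall>i\<in>{1..m}. a i \<bullet> x \<le> b i)"
  by (auto simp: feasible_set_def halfspace_le_def)

lemma closed_constraint_halfspace: "closed (halfspace_le a b)"
  using closed_halfspace_le[of a b] by (simp add: halfspace_le_def)

lemma closed_feasible_set: "closed (feasible_set m a b)"
  unfolding feasible_set_def by (intro closed_INT ballI closed_constraint_halfspace)

lemma proj_dist_halfspace_le:
  assumes "a \<noteq> 0"
  shows "proj_dist x (halfspace_le a b) \<le> max 0 (a \<bullet> x - b) / norm a"
proof -
  \<comment> \<open>Move from \<open>x\<close> along the normal just far enough to satisfy the constraint.\<close>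
  define t where "t = max 0 (a \<bullet> x - b)"
  define y where "y = x - (t / (norm a)\<^sup>2) *\<^sub>R a"
  have "a \<bullet> y = a \<bullet> x - t"
    using assms by (simp add: y_def inner_diff_right dot_square_norm)
  then have "y \<in> halfspace_le a b" by (simp add: halfspace_le_def t_def)
  then have "proj_dist x (halfspace_le a b) \<le> norm (x - y)"
    using closest_point_le[OF closed_constraint_halfspace] by (auto simp: proj_dist_def dist_norm)
  also have "norm (x - y) = t / norm a"
    by (simp add: y_def t_def power2_eq_square)
  finally show ?thesis by (simp add: t_def)
qed

lemma penalty_nonneg: "\<delta> > 0 \<Longrightarrow> 0 \<le> penalty \<delta> x a b"
  by (auto simp: penalty_def intro!: divide_nonneg_nonneg)

text \<open>The quadratic branch lies above the linear one, since \<open>(t + \<delta>)\<^sup>2 - 4 \<delta> t = (t - \<delta>)\<^sup>2\<close>.\<close>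

lemma penalty_ge_distance:
  assumes "\<delta> > 0"
  shows "max 0 (a \<bullet> x - b) / norm a \<le> penalty \<delta> x a b"
proof -
  define t where "t = a \<bullet> x - b"
  have "4 * \<delta> * t \<le> (t + \<delta>)\<^sup>2"
    using zero_le_power2[of "t - \<delta>"] by (simp add: power2_eq_square algebra_simps)
  then have "t / norm a \<le> (t + \<delta>)\<^sup>2 / (4 * \<delta> * norm a)"
    using assms by (cases "a = 0") (simp_all add: field_simps)
  then show ?thesis
    using assms by (auto simp: penalty_def max_def t_def)
qed

lemma penalty_le_if_satisfied:
  assumes "\<delta> > 0" and "a \<bullet> x \<le> b"
  shows "penalty \<delta> x a b \<le> \<delta> / (4 * norm a)"
proof -
  have "(a \<bullet> x - b + \<delta>)\<^sup>2 / (4 * \<delta> * norm a) \<le> \<delta>\<^sup>2 / (4 * \<delta> * norm a)" if "- \<delta> \<le> a \<bullet> x - b"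
    using that assms by (intro divide_right_mono power_mono) auto
  also have "\<delta>\<^sup>2 / (4 * \<delta> * norm a) = \<delta> / (4 * norm a)"
    using assms by (simp add: power2_eq_square)
  finally show ?thesis using assms by (auto simp: penalty_def)
qed

lemma penalty_gt_if_violated:
  assumes "\<delta> > 0" and "a \<noteq> 0" and "a \<bullet> x > b"
  shows "\<delta> / (4 * norm a) < penalty \<delta> x a b"
proof (cases "a \<bullet> x - b > \<delta>")
  case True
  then have "\<delta> < 4 * (a \<bullet> x - b)" using assms by simp
  then show ?thesis using True assms by (simp add: penalty_def field_simps)
next
  case False
  have "\<delta>\<^sup>2 / (4 * \<delta> * norm a) < (a \<bullet> x - b + \<delta>)\<^sup>2 / (4 * \<delta> * norm a)"
    using assms by (intro divide_strict_right_mono power_strict_mono) auto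
  then show ?thesis using False assms by (simp add: penalty_def power2_eq_square)
qed

lemma penalty_eq_0_if_strictly_satisfied: "a \<bullet> x \<le> b - \<delta> \<Longrightarrow> \<delta> > 0 \<Longrightarrow> penalty \<delta> x a b = 0"
  by (auto simp: penalty_def)

lemma alpha_min_le: "i \<in> {1..m} \<Longrightarrow> alpha_min m a \<le> norm (a i)"
  by (auto simp: alpha_min_def intro!: Min_le)

lemma alpha_max_ge: "i \<in> {1..m} \<Longrightarrow> norm (a i) \<le> alpha_max m a"
  by (auto simp: alpha_max_def intro!: Max_ge)

lemma alpha_min_pos:
  assumes "m \<ge> 1" and "\<And>i. i \<in> {1..m} \<Longrightarrow> a i \<noteq> 0"
  shows "0 < alpha_min m a"
  using assms by (simp add: alpha_min_def)

lemma penalized_objective_ge: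
  assumes "\<delta> > 0" and "\<gamma> > 0"
  shows "f x \<le> penalized_objective m a b f \<gamma> \<delta> x"
  using assms by (simp add: penalized_objective_def sum_nonneg penalty_nonneg)

lemma penalized_objective_le_if_feasible:
  assumes "\<delta> > 0" and "\<gamma> > 0" and m: "m \<ge> 1" and a: "\<And>i. i \<in> {1..m} \<Longrightarrow> a i \<noteq> 0"
    and z: "z \<in> feasible_set m a b"
  shows "penalized_objective m a b f \<gamma> \<delta> z \<le> f z + \<gamma> * \<delta> / (4 * alpha_min m a)"
proof -
  have pos: "0 < alpha_min m a" using m a by (rule alpha_min_pos)
  have "penalty \<delta> z (a i) (b i) \<le> \<delta> / (4 * alpha_min m a)" if i: "i \<in> {1..m}" for i
  proof -
    have "penalty \<delta> z (a i) (b i) \<le> \<delta> / (4 * norm (a i))"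
      using z i by (intro penalty_le_if_satisfied[OF \<open>\<delta> > 0\<close>]) (simp add: mem_feasible_set)
    also have "\<dots> \<le> \<delta> / (4 * alpha_min m a)"
      using pos alpha_min_le[OF i, of a] \<open>\<delta> > 0\<close> by (intro divide_left_mono mult_pos_pos) auto
    finally show ?thesis .
  qed
  then have "(\<Sum>i\<in>{1..m}. penalty \<delta> z (a i) (b i)) \<le> real m * (\<delta> / (4 * alpha_min m a))"
    using sum_bounded_above[of "{1..m}" "\<lambda>i. penalty \<delta> z (a i) (b i)" "\<delta> / (4 * alpha_min m a)"]
    by simp
  then have "\<gamma> / real m * (\<Sum>i\<in>{1..m}. penalty \<delta> z (a i) (b i))
      \<le> \<gamma> / real m * (real m * (\<delta> / (4 * alpha_min m a)))"
    using \<open>\<gamma> > 0\<close> by (intro mult_left_mono) auto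
  then show ?thesis using m by (simp add: penalized_objective_def)
qed

text \<open>At a point satisfying every constraint, the distance to the half-space tightened by \<open>\<delta>\<close> is at
  most \<open>\<delta> / \<parallel>a\<^sub>i\<parallel>\<close>, and Hoffman's inequality adds these distances up.\<close>

lemma hoffman_tightened_distance:
  assumes hoff: "hoffman_constant m a \<beta>" and m: "m \<ge> 1" and a: "\<And>i. i \<in> {1..m} \<Longrightarrow> a i \<noteq> 0"
    and "\<delta> > 0" and ne: "feasible_set m a (\<lambda>i. b i - \<delta>) \<noteq> {}" and p: "p \<in> feasible_set m a b"
  shows "proj_dist p (feasible_set m a (\<lambda>i. b i - \<delta>)) \<le> \<beta> * real m * \<delta> / alpha_min m a"
proof -
  have pos: "0 < alpha_min m a" using m a by (rule alpha_min_pos)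
  have "proj_dist p (halfspace_le (a i) (b i - \<delta>)) \<le> \<delta> / alpha_min m a" if i: "i \<in> {1..m}" for i
  proof -
    have "proj_dist p (halfspace_le (a i) (b i - \<delta>)) \<le> max 0 (a i \<bullet> p - (b i - \<delta>)) / norm (a i)"
      using a[OF i] by (rule proj_dist_halfspace_le)
    also have "\<dots> \<le> \<delta> / norm (a i)"
      using p i \<open>\<delta> > 0\<close> by (intro divide_right_mono) (auto simp: mem_feasible_set)
    also have "\<dots> \<le> \<delta> / alpha_min m a"
      using pos alpha_min_le[OF i, of a] \<open>\<delta> > 0\<close> by (intro divide_left_mono mult_pos_pos) auto
    finally show ?thesis .
  qed
  then have "(\<Sum>i\<in>{1..m}. proj_dist p (halfspace_le (a i) (b i - \<delta>))) \<le> real m * (\<delta> / alpha_min m a)"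
    using sum_bounded_above[of "{1..m}" "\<lambda>i. proj_dist p (halfspace_le (a i) (b i - \<delta>))"
        "\<delta> / alpha_min m a"]
    by simp
  then have "\<beta> * (\<Sum>i\<in>{1..m}. proj_dist p (halfspace_le (a i) (b i - \<delta>)))
      \<le> \<beta> * (real m * (\<delta> / alpha_min m a))"
    using hoff by (intro mult_left_mono) (auto simp: hoffman_constant_def)
  moreover have "proj_dist p (feasible_set m a (\<lambda>i. b i - \<delta>))
      \<le> \<beta> * (\<Sum>i\<in>{1..m}. proj_dist p (halfspace_le (a i) (b i - \<delta>)))"
    using hoff ne unfolding hoffman_constant_def by blast
  ultimately show ?thesis by simp
qed

lemma hoffman_sum_penalty_ge:
  assumes hoff: "hoffman_constant m a \<beta>" and a: "\<And>i. i \<in> {1..m} \<Longrightarrow> a i \<noteq> 0"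
    and "\<delta> > 0" and ne: "feasible_set m a b \<noteq> {}"
  shows "proj_dist x (feasible_set m a b) \<le> \<beta> * (\<Sum>i\<in>{1..m}. penalty \<delta> x (a i) (b i))"
proof -
  have "proj_dist x (feasible_set m a b) \<le> \<beta> * (\<Sum>i\<in>{1..m}. proj_dist x (halfspace_le (a i) (b i)))"
    using hoff ne unfolding hoffman_constant_def by blast
  also have "\<dots> \<le> \<beta> * (\<Sum>i\<in>{1..m}. penalty \<delta> x (a i) (b i))"
    using hoff a
    by (intro mult_left_mono sum_mono order_trans[OF proj_dist_halfspace_le
          penalty_ge_distance[OF \<open>\<delta> > 0\<close>]]) (auto simp: hoffman_constant_def)
  finally show ?thesis .
qed

section \<open>Feasibility of the penalized minimizers\<close>

text \<open>Were the distance \<open>d\<close> larger than \<open>\<surd>\<delta>\<close>, the penalty still paid at the projection, a multiple of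
  \<open>\<delta>\<close>, would be below the same multiple of \<open>\<surd>\<delta> d\<close>. Projecting \<open>x\<close> would then save an amount of
  penalty proportional to \<open>d\<close>, at a rate no smaller than the rate \<open>l\<close> at which \<open>f\<close> may increase.\<close>

lemma penalized_minimizer_near:
  fixes f :: "real^'n \<Rightarrow> real"
  assumes m: "m \<ge> 1" and a: "\<And>i. i \<in> {1..m} \<Longrightarrow> a i \<noteq> 0"
    and ne: "feasible_set m a b \<noteq> {}"
    and hoff: "hoffman_constant m a \<beta>"
    and "\<delta> > 0" and "\<gamma> > 0"
    and \<delta>: "\<delta> < 16 * (alpha_min m a)\<^sup>2 / (\<beta>\<^sup>2 * (real m)\<^sup>2)"
    and \<gamma>: "l * inverse (1 / (real m * \<beta>) - sqrt \<delta> / (4 * alpha_min m a)) \<le> \<gamma>"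
    and x: "x \<in> penalized_minimizers m a b f \<gamma> \<delta>"
    and decr: "f (closest_point (feasible_set m a b) x) - f x \<le> l * proj_dist x (feasible_set m a b)"
  shows "proj_dist x (feasible_set m a b) \<le> sqrt \<delta>"
proof (rule ccontr)
  define d where "d = proj_dist x (feasible_set m a b)"
  define p where "p = closest_point (feasible_set m a b) x"
  define \<alpha> where "\<alpha> = alpha_min m a"
  define S where "S = (\<Sum>i\<in>{1..m}. penalty \<delta> x (a i) (b i))"
  assume "\<not> proj_dist x (feasible_set m a b) \<le> sqrt \<delta>"
  then have d: "d > sqrt \<delta>" by (simp add: d_def)
  have "\<alpha> > 0" using m a unfolding \<alpha>_def by (rule alpha_min_pos)
  have "\<beta> > 0" using hoff by (simp add: hoffman_constant_def)
  have "d > 0" using d \<open>\<delta> > 0\<close> real_sqrt_gt_zero[of \<delta>] by linarith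
  have "sqrt \<delta> < sqrt ((4 * \<alpha> / (\<beta> * real m))\<^sup>2)"
    using \<delta> by (simp add: \<alpha>_def power_divide power_mult_distrib)
  then have "sqrt \<delta> < 4 * \<alpha> / (\<beta> * real m)"
    using \<open>\<alpha> > 0\<close> \<open>\<beta> > 0\<close> by simp
  then have slope: "0 < 1 / (real m * \<beta>) - sqrt \<delta> / (4 * \<alpha>)"
    using \<open>\<alpha> > 0\<close> \<open>\<beta> > 0\<close> m by (simp add: field_simps)
  have p: "p \<in> feasible_set m a b"
    unfolding p_def using closed_feasible_set ne by (rule closest_point_in_set)
  have "penalized_objective m a b f \<gamma> \<delta> x \<le> f p + \<gamma> * \<delta> / (4 * \<alpha>)"
    using order_trans[OF _ penalized_objective_le_if_feasible[OF \<open>\<delta> > 0\<close> \<open>\<gamma> > 0\<close> m a p]] x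
    by (simp add: penalized_minimizers_def \<alpha>_def)
  then have "\<gamma> / real m * S \<le> l * d + \<gamma> * \<delta> / (4 * \<alpha>)"
    using decr by (simp add: penalized_objective_def S_def d_def p_def)
  moreover have "\<gamma> / real m * (d / \<beta>) \<le> \<gamma> / real m * S"
    using hoffman_sum_penalty_ge[OF hoff a \<open>\<delta> > 0\<close> ne, of x] \<open>\<beta> > 0\<close> \<open>\<gamma> > 0\<close>
    by (intro mult_left_mono) (auto simp: d_def S_def field_simps)
  moreover have "\<gamma> * \<delta> / (4 * \<alpha>) < \<gamma> * (sqrt \<delta> * d) / (4 * \<alpha>)"
  proof -
    have "\<delta> < sqrt \<delta> * d"
      using mult_strict_left_mono[OF d, of "sqrt \<delta>"] \<open>\<delta> > 0\<close> by simp
    then show ?thesis using \<open>\<gamma> > 0\<close> \<open>\<alpha> > 0\<close> by (simp add: divide_strict_right_mono)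
  qed
  ultimately have "\<gamma> / real m * (d / \<beta>) < l * d + \<gamma> * (sqrt \<delta> * d) / (4 * \<alpha>)" by linarith
  then have "(\<gamma> * (1 / (real m * \<beta>) - sqrt \<delta> / (4 * \<alpha>))) * d < l * d"
    by (simp add: algebra_simps)
  then have "\<gamma> * (1 / (real m * \<beta>) - sqrt \<delta> / (4 * \<alpha>)) < l"
    using \<open>d > 0\<close> by simp
  moreover have "l \<le> \<gamma> * (1 / (real m * \<beta>) - sqrt \<delta> / (4 * \<alpha>))"
    using \<gamma> slope by (simp add: \<alpha>_def pos_divide_le_eq flip: divide_inverse)
  ultimately show False by linarith
qed

text \<open>Since the penalty of a constraint already equals \<open>\<delta> / (4 \<parallel>a\<^sub>i\<parallel>)\<close> on its boundary, comparison
  with a point where no penalty is paid excludes even the smallest infeasibility.\<close>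

lemma penalized_minimizer_feasible_if_near:
  fixes f :: "real^'n \<Rightarrow> real"
  assumes m: "m \<ge> 1" and a: "\<And>i. i \<in> {1..m} \<Longrightarrow> a i \<noteq> 0"
    and "\<delta> > 0" and "\<gamma> > 0" and "l \<ge> 0"
    and \<gamma>: "4 * real m * l * alpha_max m a * (1 / sqrt \<delta> + \<beta> * real m / alpha_min m a) \<le> \<gamma>"
    and x: "x \<in> penalized_minimizers m a b f \<gamma> \<delta>"
    and q: "q \<in> feasible_set m a (\<lambda>i. b i - \<delta>)"
    and decr: "f q - f x \<le> l * norm (x - q)"
    and near: "norm (x - q) \<le> sqrt \<delta> + \<beta> * real m * \<delta> / alpha_min m a"
  shows "x \<in> feasible_set m a b"
proof (rule ccontr)
  assume "x \<notin> feasible_set m a b"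
  then obtain i where i: "i \<in> {1..m}" "a i \<bullet> x > b i"
    by (auto simp: mem_feasible_set not_le)
  define A where "A = alpha_max m a"
  define K where "K = 1 / sqrt \<delta> + \<beta> * real m / alpha_min m a"
  have "A > 0" using alpha_max_ge[OF i(1), of a] a[OF i(1)] unfolding A_def
    by (metis less_le_trans zero_less_norm_iff)
  have "\<delta> / (4 * A) \<le> \<delta> / (4 * norm (a i))"
    using alpha_max_ge[OF i(1), of a] a[OF i(1)] \<open>\<delta> > 0\<close> \<open>A > 0\<close>
    by (intro divide_left_mono) (auto simp: A_def)
  also have "\<dots> < penalty \<delta> x (a i) (b i)"
    using penalty_gt_if_violated[OF \<open>\<delta> > 0\<close> a[OF i(1)] i(2)] .
  also have "\<dots> \<le> (\<Sum>i\<in>{1..m}. penalty \<delta> x (a i) (b i))"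
    using i(1) by (intro member_le_sum) (auto intro: penalty_nonneg[OF \<open>\<delta> > 0\<close>])
  finally have "\<gamma> / real m * (\<delta> / (4 * A)) < \<gamma> / real m * (\<Sum>i\<in>{1..m}. penalty \<delta> x (a i) (b i))"
    using \<open>\<gamma> > 0\<close> m by (intro mult_strict_left_mono) auto
  moreover have "penalized_objective m a b f \<gamma> \<delta> q = f q"
    using q \<open>\<delta> > 0\<close>
    by (simp add: penalized_objective_def mem_feasible_set penalty_eq_0_if_strictly_satisfied)
  then have "penalized_objective m a b f \<gamma> \<delta> x \<le> f q"
    using x by (metis (mono_tags) mem_Collect_eq penalized_minimizers_def)
  then have "\<gamma> / real m * (\<Sum>i\<in>{1..m}. penalty \<delta> x (a i) (b i)) \<le> f q - f x"
    by (simp add: penalized_objective_def)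
  ultimately have "\<gamma> / real m * (\<delta> / (4 * A)) < l * norm (x - q)" using decr by linarith
  also have "\<dots> \<le> l * (sqrt \<delta> + \<beta> * real m * \<delta> / alpha_min m a)"
    using near \<open>l \<ge> 0\<close> by (rule mult_left_mono)
  also have "sqrt \<delta> + \<beta> * real m * \<delta> / alpha_min m a = K * \<delta>"
    using real_div_sqrt[of \<delta>] \<open>\<delta> > 0\<close> by (simp add: K_def distrib_right)
  finally have "(\<gamma> / real m / (4 * A)) * \<delta> < (l * K) * \<delta>" by simp
  then have "\<gamma> / real m / (4 * A) < l * K" using \<open>\<delta> > 0\<close> by (simp only: mult_less_cancel_right_pos)
  then have "\<gamma> < 4 * real m * l * A * K"
    using m \<open>A > 0\<close> by (simp add: field_simps)
  then show False using \<gamma> by (simp add: A_def K_def)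
qed

section \<open>Accuracy of the penalized minimizers\<close>

lemma constrained_minimum_attained:
  fixes f :: "real^'n \<Rightarrow> real"
  assumes conv: "convex_on UNIV f" and lev: "\<And>t. bounded {x. f x \<le> t}"
    and "closed X" and "X \<noteq> {}"
  shows "\<exists>z\<in>X. (LEAST v. v \<in> f ` X) = f z \<and> (\<forall>y\<in>X. f z \<le> f y)"
proof -
  obtain x0 where x0: "x0 \<in> X" using \<open>X \<noteq> {}\<close> by blast
  have cont: "continuous_on UNIV f" using convex_on_continuous[OF open_UNIV conv] .
  define C where "C = X \<inter> {x. f x \<le> f x0}"
  have "closed {x. f x \<le> f x0}" using cont by (intro closed_Collect_le) auto
  then have "compact C"
    unfolding C_def compact_eq_bounded_closed using \<open>closed X\<close> lev by (auto simp: bounded_Int)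
  moreover have "x0 \<in> C" using x0 by (simp add: C_def)
  ultimately obtain z where z: "z \<in> C" "\<forall>y\<in>C. f z \<le> f y"
    using continuous_attains_inf[of C f] continuous_on_subset[OF cont] by blast
  have min: "f z \<le> f y" if "y \<in> X" for y
    using z that by (cases "f y \<le> f x0") (auto simp: C_def)
  have "z \<in> X" using z by (simp add: C_def)
  moreover have "(LEAST v. v \<in> f ` X) = f z"
    using \<open>z \<in> X\<close> min by (intro Least_equality) auto
  ultimately show ?thesis using min by blast
qed

theorem proposition3:
  fixes f :: "real^'n \<Rightarrow> real"
    and a :: "nat \<Rightarrow> real^'n" and b :: "nat \<Rightarrow> real" and m :: nat
    and xbar :: "real^'n"
    and \<epsilon> \<beta> c R L \<delta>0 \<delta> \<gamma> \<Gamma> fstar :: real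
  assumes "m \<ge> 2"
    and "\<And>i. i \<in> {1..m} \<Longrightarrow> a i \<noteq> 0"
    and "feasible_set m a b \<noteq> {}"
    and "\<delta>0 > 0"
    and "convex_on UNIV f"
    and "\<And>t. bounded {x. f x \<le> t}"
    and "\<epsilon> > 0"
    and "\<And>j. j \<in> {1..m} \<Longrightarrow> a j \<bullet> xbar - b j \<le> - \<epsilon>"
    and "hoffman_constant m a \<beta>"
    and "c > 4 * alpha_min m a * \<delta>0"
    and "admissible_radius m a b f \<beta> c \<epsilon> R"
    and "L = subgradient_bound f R"
    and "0 < \<delta>"
    and "\<delta> < min \<epsilon> (16 * (alpha_min m a)\<^sup>2 / (\<beta>\<^sup>2 * (real m)\<^sup>2))"
    and "\<Gamma> = max (L * inverse (1 / (real m * \<beta>) - sqrt \<delta> / (4 * alpha_min m a)))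
                 (4 * real m * L * alpha_max m a * (1 / sqrt \<delta> + \<beta> * real m / alpha_min m a))"
    and "\<gamma> > 0"
    and "\<Gamma> \<le> \<gamma>"
    and "\<gamma> \<le> 4 * alpha_min m a * \<delta>0 / \<delta>"
    and "fstar = (LEAST v. v \<in> f ` feasible_set m a b)"
  shows "\<forall>x \<in> penalized_minimizers m a b f \<gamma> \<delta>. 0 \<le> f x - fstar \<and> f x - fstar \<le> \<delta>0"
proof
  fix x assume x: "x \<in> penalized_minimizers m a b f \<gamma> \<delta>"
  define X where "X = feasible_set m a b"
  define X\<delta> where "X\<delta> = feasible_set m a (\<lambda>i. b i - \<delta>)"
  define p where "p = closest_point X x"
  define q where "q = closest_point X\<delta> p"
  have m: "m \<ge> 1" using assms(1) by simp
  note a = assms(2) and \<delta> = \<open>0 < \<delta>\<close> and \<gamma> = \<open>\<gamma> > 0\<close>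
  have \<alpha>: "0 < alpha_min m a" using m a by (rule alpha_min_pos)
  have "\<delta> < \<epsilon>" and \<delta>_small: "\<delta> < 16 * (alpha_min m a)\<^sup>2 / (\<beta>\<^sup>2 * (real m)\<^sup>2)"
    using assms(14) by auto
  have \<gamma>1: "L * inverse (1 / (real m * \<beta>) - sqrt \<delta> / (4 * alpha_min m a)) \<le> \<gamma>"
    and \<gamma>2: "4 * real m * L * alpha_max m a * (1 / sqrt \<delta> + \<beta> * real m / alpha_min m a) \<le> \<gamma>"
    using assms(15,17) by auto
  have \<gamma>\<delta>: "\<gamma> * \<delta> \<le> 4 * alpha_min m a * \<delta>0"
    using assms(18) \<delta> by (simp add: pos_le_divide_eq)
  have L: "L \<ge> 0"
    using subgradient_bound_nonneg[OF assms(5), of R] assms(11,12) by (simp add: admissible_radius_def)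
  have decr: "f y - f x \<le> L * norm (x - y)" if "y \<in> cball 0 R" for y
    using decrease_le_subgradient_bound[OF assms(5) that] assms(12) by simp

  have X: "p \<in> X"
    unfolding p_def X_def using closed_feasible_set assms(3) by (rule closest_point_in_set)
  have "xbar \<in> X\<delta>"
    using assms(8) \<open>\<delta> < \<epsilon>\<close> by (force simp: X\<delta>_def mem_feasible_set)
  then have ne: "feasible_set m a (\<lambda>i. b i - \<delta>) \<noteq> {}" by (auto simp: X\<delta>_def)
  have q: "q \<in> X\<delta>"
    unfolding q_def X\<delta>_def using closed_feasible_set ne by (rule closest_point_in_set)
  then have "q \<in> X" using \<delta> by (force simp: X\<delta>_def X_def mem_feasible_set)
  have "norm (p - q) \<le> \<beta> * real m * \<delta> / alpha_min m a"
    using hoffman_tightened_distance[OF assms(9) m a \<delta> ne] X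
    by (simp add: X_def X\<delta>_def q_def proj_dist_def)
  then have xq: "norm (x - q) \<le> norm (x - p) + \<beta> * real m * \<delta> / alpha_min m a"
    using norm_triangle_ineq[of "x - p" "p - q"] by simp
  have "\<gamma> * \<delta> \<le> c" "\<delta> \<le> \<epsilon>" using \<gamma>\<delta> assms(10) \<open>\<delta> < \<epsilon>\<close> by auto
  then have "p \<in> cball 0 R" "q \<in> cball 0 R"
    using assms(11) x \<gamma> \<delta> \<open>q \<in> X\<close> xq unfolding admissible_radius_def p_def X_def by blast+

  have "norm (x - p) \<le> sqrt \<delta>"
    using penalized_minimizer_near[OF m a assms(3,9) \<delta> \<gamma> \<delta>_small \<gamma>1 x]
      decr[OF \<open>p \<in> cball 0 R\<close>] by (simp add: proj_dist_def p_def X_def)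
  then have "norm (x - q) \<le> sqrt \<delta> + \<beta> * real m * \<delta> / alpha_min m a"
    using xq by linarith
  then have "x \<in> X"
    using penalized_minimizer_feasible_if_near[OF m a \<delta> \<gamma> L \<gamma>2 x _ decr[OF \<open>q \<in> cball 0 R\<close>]] q
    by (simp add: X_def X\<delta>_def)

  obtain z where z: "z \<in> X" "fstar = f z" "\<forall>y\<in>X. f z \<le> f y"
    using constrained_minimum_attained[OF assms(5,6) closed_feasible_set assms(3)]
    unfolding X_def assms(19) by blast
  have "f x \<le> penalized_objective m a b f \<gamma> \<delta> x"
    using \<delta> \<gamma> by (rule penalized_objective_ge)
  also have "\<dots> \<le> penalized_objective m a b f \<gamma> \<delta> z"
    using x by (simp add: penalized_minimizers_def)
  also have "\<dots> \<le> f z + \<gamma> * \<delta> / (4 * alpha_min m a)"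
    using penalized_objective_le_if_feasible[OF \<delta> \<gamma> m a] z(1) by (simp add: X_def)
  also have "\<dots> \<le> f z + \<delta>0"
    using \<gamma>\<delta> \<alpha> by (simp add: pos_divide_le_eq mult_ac)
  finally show "0 \<le> f x - fstar \<and> f x - fstar \<le> \<delta>0"
    using z \<open>x \<in> X\<close> by simp
qed

end
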